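(* Let $n=p+k$ be the number of vertices of the broom $\mathcal B_{k,p}$. If $p/k\to0$ as $n\to\infty$, then $B_2=O(k)$.
   Context: For $k\ge3$ and $p\ge2$, the broom $\mathcal B_{k,p}$ is obtained from the path $\mathcal P_k=(1,\dots,k)$ and a star with $p$ leaves by identifying vertex $k$ of the path with the star's center. $B_2$ denotes the number of Braess edges of $\mathcal B_{k,p}$ joining a vertex of $\mathcal P_k$ to a pendent vertex of the star part. For a connected graph $G$, $\kappa(G)$ is Kemeny's constant of the simple random walk on $G$: $\kappa(G)=\sum_{j\ne i}m_{ij}\pi_j$ ($m_{ij}$ mean first passage time, $\pi$ stationary distribution); a pair of nonadjacent vertices is a Braess edge if adding the edge between them strictly increases $\kappa$. *)

theory Defs
  imports "HOL-Probability.Probability" "HOL-Library.Landau_Symbols"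
begin

record 'a ugraph =
  verts :: "'a set"
  edges :: "'a set set"

definition neighbours :: "'a ugraph \<Rightarrow> 'a \<Rightarrow> 'a set" where
  "neighbours G u = {v \<in> verts G. v \<noteq> u \<and> {u, v} \<in> edges G}"

definition add_edge :: "'a ugraph \<Rightarrow> 'a set \<Rightarrow> 'a ugraph" where
  "add_edge G e = G\<lparr>edges := insert e (edges G)\<rparr>"

text \<open>The notions below are meaningful for a finite connected graph with at least two vertices:
  there every vertex has a neighbour, the stationary distribution is unique, and all mean first
  passage times are finite.\<close>

definition step :: "'a ugraph \<Rightarrow> 'a \<Rightarrow> 'a pmf" where
  "step G u = pmf_of_set (neighbours G u)"

text \<open>\<open>walk G t u\<close> is the law of the trajectory \<open>[X\<^sub>0, \<dots>, X\<^sub>t]\<close> of the walk started at \<open>X\<^sub>0 = u\<close>.\<close>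

primrec walk :: "'a ugraph \<Rightarrow> nat \<Rightarrow> 'a \<Rightarrow> 'a list pmf" where
  "walk G 0 u = return_pmf [u]"
| "walk G (Suc t) u = bind_pmf (step G u) (\<lambda>v. map_pmf ((#) u) (walk G t v))"

text \<open>The probability that \<open>min {t. t \<ge> 1 \<and> X\<^sub>t = v}\<close> equals \<open>t\<close>.\<close>

definition first_passage_prob :: "'a ugraph \<Rightarrow> 'a \<Rightarrow> 'a \<Rightarrow> nat \<Rightarrow> real" where
  "first_passage_prob G u v t =
     (if t = 0 then 0
      else measure_pmf.prob (walk G t u) {xs. xs ! t = v \<and> (\<forall>s. 1 \<le> s \<and> s < t \<longrightarrow> xs ! s \<noteq> v)})"

definition mean_first_passage :: "'a ugraph \<Rightarrow> 'a \<Rightarrow> 'a \<Rightarrow> real" where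
  "mean_first_passage G u v = (\<Sum>t. real t * first_passage_prob G u v t)"

definition stationary :: "'a ugraph \<Rightarrow> 'a pmf" where
  "stationary G = (THE q. set_pmf q \<subseteq> verts G \<and> bind_pmf q (step G) = q)"

text \<open>The sum does not depend on the starting vertex \<open>i\<close>; Kemeny's constant is its common value.\<close>

definition kemeny :: "'a ugraph \<Rightarrow> real" where
  "kemeny G = (THE c. \<forall>i\<in>verts G.
     (\<Sum>j\<in>verts G - {i}. mean_first_passage G i j * pmf (stationary G) j) = c)"

definition braess_edges :: "'a ugraph \<Rightarrow> 'a set set" where
  "braess_edges G = {{u, v} | u v. u \<in> verts G \<and> v \<in> verts G \<and> u \<noteq> v \<and> {u, v} \<notin> edges G \<and>
     kemeny G < kemeny (add_edge G {u, v})}"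

text \<open>The path is \<open>1, \<dots>, k\<close> and the pendent vertices of the star are \<open>k + 1, \<dots>, k + p\<close>.\<close>

definition broom :: "nat \<Rightarrow> nat \<Rightarrow> nat ugraph" where
  "broom k p = \<lparr>verts = {1..k + p},
     edges = {{i, i + 1} | i. 1 \<le> i \<and> i < k} \<union> {{k, l} | l. k + 1 \<le> l \<and> l \<le> k + p}\<rparr>"

definition B\<^sub>2 :: "nat \<Rightarrow> nat \<Rightarrow> nat" where
  "B\<^sub>2 k p = card (braess_edges (broom k p) \<inter> {{i, l} | i l. i \<in> {1..k} \<and> l \<in> {k + 1..k + p}})"

lemma card_verts_broom: "card (verts (broom k p)) = p + k"
  by (simp add: broom_def)

end

theory Submission
  imports Defs
begin

text \<open>
  If \<open>R\<close> is the effective resistance of a graph with degrees \<open>d\<close> and \<open>W = \<Sum>x. d x\<close>, then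
  \<open>\<kappa> = (\<Sum>x. \<Sum>y. d x * d y * R x y) / (2 * W)\<close>. Adding an edge \<open>ab\<close> changes \<open>R x y\<close> into
  \<open>R x y - (g x - g y)\<^sup>2 / (1 + R a b)\<close> with \<open>g x = (R x a - R x b) / 2\<close>, and it raises the degrees of
  \<open>a\<close> and \<open>b\<close>. For the broom with \<open>p \<le> k\<close>, \<open>a = i\<close> on the path and \<open>b\<close> pendent, the change of degrees
  increases the double sum by \<open>O(k\<^sup>2)\<close>. The change of \<open>R\<close> decreases it by at least a constant multiple
  of \<open>p * k * (k - i)\<close>: already the pairs of the vertex \<open>k\<close>, of degree at least \<open>p\<close>, with
  about half of the path contribute this much. Hence a Braess edge has \<open>p * (k - i) = O(k)\<close>, which
  leaves \<open>O(k / p)\<close> choices for \<open>i\<close> and \<open>p\<close> choices for the pendent vertex.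
\<close>

section \<open>Random walks on finite graphs\<close>

definition deg :: "'a ugraph \<Rightarrow> 'a \<Rightarrow> real" where
  "deg G u = real (card (neighbours G u))"

definition total_deg :: "'a ugraph \<Rightarrow> real" where
  "total_deg G = (\<Sum>u\<in>verts G. deg G u)"

locale fin_graph =
  fixes G :: "'a ugraph"
  assumes finite_verts: "finite (verts G)"
    and verts_nonempty: "verts G \<noteq> {}"
    and neighbours_nonempty: "u \<in> verts G \<Longrightarrow> neighbours G u \<noteq> {}"
begin

lemma neighbours_subset: "neighbours G u \<subseteq> verts G"
  by (auto simp: neighbours_def)

lemma finite_neighbours: "finite (neighbours G u)"
  using neighbours_subset finite_verts by (rule finite_subset)

lemma deg_pos: "u \<in> verts G \<Longrightarrow> deg G u > 0"
  using neighbours_nonempty[of u] finite_neighbours[of u] by (simp add: deg_def card_gt_0_iff)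

lemma deg_nonneg: "deg G u \<ge> 0"
  by (simp add: deg_def)

lemma total_deg_pos: "total_deg G > 0"
  unfolding total_deg_def using finite_verts verts_nonempty deg_pos by (intro sum_pos) auto

section \<open>First-step analysis of first passage probabilities\<close>

lemma prob_bind_step:
  assumes "u \<in> verts G"
  shows "measure_pmf.prob (bind_pmf (step G u) f) A
    = (\<Sum>w\<in>neighbours G u. measure_pmf.prob (f w) A) / deg G u"
proof -
  \<comment> \<open>An event is recoded as a Boolean random variable, so that the law of total
    probability for point masses applies.\<close>
  have prob_eq: "measure_pmf.prob M A = pmf (map_pmf (\<lambda>x. x \<in> A) M) True" for M :: "'b pmf"
    by (simp add: pmf_map vimage_def)
  show ?thesis
    unfolding prob_eq map_bind_pmf step_def deg_def
    by (rule pmf_bind_pmf_of_set[OF neighbours_nonempty[OF assms] finite_neighbours])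
qed

lemma nth_0_walk: "xs \<in> set_pmf (walk G t u) \<Longrightarrow> xs ! 0 = u"
  by (cases t) auto

text \<open>Condition on the first step to \<open>w\<close>: if \<open>w = v\<close>, the passage
  happens at time 1; otherwise the walk starts afresh from \<open>w\<close> with one unit of time
  less.\<close>

lemma first_passage_prob_Suc:
  assumes u: "u \<in> verts G"
  shows "first_passage_prob G u v (Suc t) = (\<Sum>w\<in>neighbours G u.
    if w = v then (if t = 0 then 1 else 0) else first_passage_prob G w v t) / deg G u"
proof -
  let ?A = "{xs. xs ! Suc t = v \<and> (\<forall>s. 1 \<le> s \<and> s < Suc t \<longrightarrow> xs ! s \<noteq> v)}"
  have "measure_pmf.prob (map_pmf ((#) u) (walk G t w)) ?A
    = (if w = v then (if t = 0 then 1 else 0) else first_passage_prob G w v t)" for w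
  proof -
    have "(\<forall>s. 1 \<le> s \<and> s < Suc t \<longrightarrow> (u # ys) ! s \<noteq> v) \<longleftrightarrow> (\<forall>s<t. ys ! s \<noteq> v)" for ys
    proof (intro iffI allI impI)
      fix s
      assume "\<forall>s. 1 \<le> s \<and> s < Suc t \<longrightarrow> (u # ys) ! s \<noteq> v" "s < t"
      then show "ys ! s \<noteq> v" by (auto dest: spec[of _ "Suc s"])
    next
      fix s
      assume "\<forall>s<t. ys ! s \<noteq> v" "1 \<le> s \<and> s < Suc t"
      then show "(u # ys) ! s \<noteq> v" by (cases s) auto
    qed
    then have "(#) u -` ?A = {ys. ys ! t = v \<and> (\<forall>s<t. ys ! s \<noteq> v)}"
      by auto
    then have eq: "measure_pmf.prob (map_pmf ((#) u) (walk G t w)) ?A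
      = measure_pmf.prob (walk G t w) {ys. ys ! t = v \<and> (\<forall>s<t. ys ! s \<noteq> v)}"
      by simp
    show ?thesis
    proof (cases "t = 0")
      case True
      then show ?thesis unfolding eq by (simp add: first_passage_prob_def)
    next
      case False
      \<comment> \<open>The range \<open>s < t\<close> includes time 0, where the walk is at
        \<open>w\<close>; this accounts for the conjunct \<open>w \<noteq> v\<close>.\<close>
      have "ys ! t = v \<and> (\<forall>s<t. ys ! s \<noteq> v) \<longleftrightarrow>
        w \<noteq> v \<and> ys ! t = v \<and> (\<forall>s. 1 \<le> s \<and> s < t \<longrightarrow> ys ! s \<noteq> v)"
        if "ys \<in> set_pmf (walk G t w)" for ys
        using nth_0_walk[OF that] False by (metis less_one linorder_not_le neq0_conv)
      then have "measure_pmf.prob (walk G t w) {ys. ys ! t = v \<and> (\<forall>s<t. ys ! s \<noteq> v)}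
        = measure_pmf.prob (walk G t w)
          {ys. w \<noteq> v \<and> ys ! t = v \<and> (\<forall>s. 1 \<le> s \<and> s < t \<longrightarrow> ys ! s \<noteq> v)}"
        by (intro measure_pmf.finite_measure_eq_AE) (auto simp: AE_measure_pmf_iff)
      then show ?thesis unfolding eq using False by (simp add: first_passage_prob_def)
    qed
  qed
  then show ?thesis
    by (simp add: first_passage_prob_def prob_bind_step[OF u] del: measure_map_pmf)
qed

text \<open>The tail of the first passage time: the probability that \<open>v\<close> is not visited
  at times 1 to \<open>t\<close>.\<close>

definition survival :: "'a \<Rightarrow> nat \<Rightarrow> 'a \<Rightarrow> real" where
  "survival v t u = 1 - (\<Sum>s\<le>t. first_passage_prob G u v s)"

lemma survival_0: "survival v 0 u = 1"
  by (simp add: survival_def first_passage_prob_def)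

lemma survival_Suc:
  assumes u: "u \<in> verts G"
  shows "survival v (Suc t) u
    = (\<Sum>w\<in>neighbours G u. if w = v then 0 else survival v t w) / deg G u"
proof -
  let ?F = "first_passage_prob G"
  have "(\<Sum>s\<le>Suc t. ?F u v s) = (\<Sum>s\<le>t. ?F u v (Suc s))"
    by (subst sum.atMost_Suc_shift) (simp add: first_passage_prob_def)
  also have "\<dots> = (\<Sum>w\<in>neighbours G u.
      \<Sum>s\<le>t. if w = v then (if s = 0 then 1 else 0) else ?F w v s) / deg G u"
    by (subst sum.swap) (simp add: first_passage_prob_Suc[OF u] sum_divide_distrib)
  also have "\<dots> = (\<Sum>w\<in>neighbours G u. 1 - (if w = v then 0 else survival v t w)) / deg G u"
    by (intro arg_cong2[where f = "(/)"] sum.cong) (auto simp: survival_def)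
  also have "\<dots> = 1 - (\<Sum>w\<in>neighbours G u. if w = v then 0 else survival v t w) / deg G u"
    using deg_pos[OF u] by (simp add: sum_subtractf deg_def diff_divide_distrib)
  finally show ?thesis by (simp add: survival_def)
qed

lemma survival_nonneg: "u \<in> verts G \<Longrightarrow> survival v t u \<ge> 0"
proof (induction t arbitrary: u)
  case (Suc t)
  then show ?case
    using subsetD[OF neighbours_subset]
    by (auto simp: survival_Suc intro!: divide_nonneg_nonneg sum_nonneg deg_nonneg)
qed (simp add: survival_0)

lemma first_passage_prob_nonneg: "first_passage_prob G u v t \<ge> 0"
  by (simp add: first_passage_prob_def)

lemma survival_antimono: "s \<le> t \<Longrightarrow> survival v t u \<le> survival v s u"
  unfolding survival_def
  using sum_mono2[of "{..t}" "{..s}" "first_passage_prob G u v"] first_passage_prob_nonneg by simp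

text \<open>Solvability of the hitting time equations already forces the target to be reached, so no
  connectedness assumption is needed.\<close>

lemma hitting_time_nonneg:
  assumes v: "v \<in> verts G" "h v = 0"
    and h: "\<And>u. u \<in> verts G \<Longrightarrow> u \<noteq> v \<Longrightarrow> h u = 1 + (\<Sum>w\<in>neighbours G u. h w) / deg G u"
    and u: "u \<in> verts G"
  shows "h u \<ge> (0::real)"
proof -
  obtain x where x: "x \<in> verts G" "\<And>y. y \<in> verts G \<Longrightarrow> h x \<le> h y"
    using finite_verts verts_nonempty by (metis arg_min_if_finite not_le_imp_less)
  have "x = v"
  proof (rule ccontr)
    assume "x \<noteq> v"
    \<comment> \<open>At a minimum other than \<open>v\<close> the mean of \<open>h\<close> over the
      neighbours is at least \<open>h x\<close>, whereas the equation makes it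
      \<open>h x - 1\<close>.\<close>
    have "(\<Sum>w\<in>neighbours G x. h w) \<ge> (\<Sum>w\<in>neighbours G x. h x)"
      using x neighbours_subset by (intro sum_mono) auto
    then have "(\<Sum>w\<in>neighbours G x. h w) / deg G x \<ge> h x"
      using deg_pos[OF x(1)] by (simp add: deg_def field_simps)
    then show False using h[OF x(1) \<open>x \<noteq> v\<close>] by simp
  qed
  then show ?thesis using x(2)[OF u] v by simp
qed

text \<open>A mean is the sum of the tail probabilities. The error \<open>e\<close> of their partial
  sums against \<open>h\<close> obeys the same recursion as \<open>survival\<close>, which traps it
  between 0 and a multiple of the tail.\<close>

lemma mean_first_passage_eq:
  assumes v: "v \<in> verts G" "h v = 0"
    and h: "\<And>u. u \<in> verts G \<Longrightarrow> u \<noteq> v \<Longrightarrow> h u = 1 + (\<Sum>w\<in>neighbours G u. h w) / deg G u"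
    and u: "u \<in> verts G" "u \<noteq> v"
  shows "mean_first_passage G u v = (h u :: real)"
proof -
  define M where "M = Max (h ` verts G)"
  have M: "h w \<le> M" if "w \<in> verts G" for w
    unfolding M_def using finite_verts that by simp
  have h_nonneg: "h w \<ge> 0" if "w \<in> verts G" for w
    using hitting_time_nonneg[OF v h] that by blast
  define e where "e t w = h w - (\<Sum>s<t. survival v s w)" for t w
  have e: "0 \<le> e t w \<and> e t w \<le> M * survival v t w" if "w \<in> verts G" "w \<noteq> v" for t w
    using that
  proof (induction t arbitrary: w)
    case 0
    then show ?case using M h_nonneg by (simp add: e_def survival_0)
  next
    case (Suc t)
    let ?N = "neighbours G w"
    have "(\<Sum>s<Suc t. survival v s w)
      = 1 + (\<Sum>x\<in>?N. \<Sum>s<t. if x = v then 0 else survival v s x) / deg G w"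
      by (subst sum.lessThan_Suc_shift, subst sum.swap)
        (simp add: survival_0 survival_Suc[OF Suc.prems(1)] sum_divide_distrib)
    then have "e (Suc t) w
      = (\<Sum>x\<in>?N. h x - (\<Sum>s<t. if x = v then 0 else survival v s x)) / deg G w"
      unfolding e_def using h[OF Suc.prems] by (simp add: sum_subtractf diff_divide_distrib)
    also have "\<dots> = (\<Sum>x\<in>?N. if x = v then 0 else e t x) / deg G w"
      by (intro arg_cong2[where f = "(/)"] sum.cong) (auto simp: e_def v)
    finally have eq: "e (Suc t) w = (\<Sum>x\<in>?N. if x = v then 0 else e t x) / deg G w" .
    have "(\<Sum>x\<in>?N. if x = v then 0 else e t x) \<ge> 0"
      using Suc.IH neighbours_subset by (intro sum_nonneg) auto
    moreover have "(\<Sum>x\<in>?N. if x = v then 0 else e t x)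
      \<le> (\<Sum>x\<in>?N. M * (if x = v then 0 else survival v t x))"
      using Suc.IH neighbours_subset by (intro sum_mono) auto
    ultimately show ?case
      using deg_pos[OF Suc.prems(1)]
      by (simp add: eq survival_Suc[OF Suc.prems(1)] divide_right_mono flip: sum_distrib_left)
  qed
  \<comment> \<open>Since \<open>e\<close> is nonnegative, the partial sums stay below
    \<open>h u\<close>; hence the tails tend to 0, and \<open>e\<close> with them.\<close>
  have "summable (\<lambda>t. survival v t u)"
  proof (rule summableI_nonneg_bounded)
    show "(\<Sum>s<t. survival v s u) \<le> h u" for t
      using e[OF u, of t] by (simp add: e_def)
  qed (use survival_nonneg u in auto)
  then have surv_0: "(\<lambda>t. survival v t u) \<longlonglongrightarrow> 0"
    by (rule summable_LIMSEQ_zero)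
  have e_0: "(\<lambda>t. e t u) \<longlonglongrightarrow> 0"
  proof (rule tendsto_sandwich[OF _ _ tendsto_const])
    show "(\<lambda>t. M * survival v t u) \<longlonglongrightarrow> 0"
      using tendsto_mult_left[OF surv_0, of M] by simp
  qed (use e[OF u] in auto)
  \<comment> \<open>The tails decrease in \<open>t\<close>, so the product is at most twice their
    sum from \<open>t div 2\<close> to \<open>t\<close>, a vanishing piece of a convergent
    series.\<close>
  have tail: "real t * survival v t u \<le> 2 * e (t div 2) u" for t
  proof -
    have "real (t - t div 2) * survival v t u = (\<Sum>s\<in>{t div 2..<t}. survival v t u)"
      by simp
    also have "\<dots> \<le> (\<Sum>s\<in>{t div 2..<t}. survival v s u)"
      by (intro sum_mono survival_antimono) auto
    also have "\<dots> = e (t div 2) u - e t u"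
      using sum.atLeastLessThan_concat[of 0 "t div 2" t "\<lambda>s. survival v s u"]
      by (simp add: e_def atLeast0LessThan)
    also have "\<dots> \<le> e (t div 2) u"
      using e[OF u] by simp
    finally have *: "real (t - t div 2) * survival v t u \<le> e (t div 2) u" .
    have "real t \<le> 2 * real (t - t div 2)" by linarith
    then have "real t * survival v t u \<le> 2 * real (t - t div 2) * survival v t u"
      using survival_nonneg[OF u(1)] by (intro mult_right_mono) auto
    with * show ?thesis by linarith
  qed
  have "filterlim (\<lambda>t::nat. t div 2) at_top sequentially"
    by (rule filterlim_at_top_div_const_nat) simp
  have t_surv: "(\<lambda>t. real t * survival v t u) \<longlonglongrightarrow> 0"
  proof (rule tendsto_sandwich[OF _ _ tendsto_const])
    have "(\<lambda>t. e (t div 2) u) \<longlonglongrightarrow> 0"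
      by (rule filterlim_compose[OF e_0]) fact
    then show "(\<lambda>t. 2 * e (t div 2) u) \<longlonglongrightarrow> 0"
      using tendsto_mult_left[of _ 0 _ 2] by simp
  qed (use tail survival_nonneg[OF u(1)] in auto)
  \<comment> \<open>Summation by parts, with boundary term
    \<open>t * survival v t u\<close>.\<close>
  have "(\<Sum>s<Suc t. real s * first_passage_prob G u v s) = h u - e t u - real t * survival v t u" for t
  proof (induction t)
    case (Suc t)
    have F: "first_passage_prob G u v (Suc t) = survival v t u - survival v (Suc t) u"
      by (simp add: survival_def)
    have "(\<Sum>s<Suc (Suc t). real s * first_passage_prob G u v s)
        = h u - e t u - real t * survival v t u + real (Suc t) * first_passage_prob G u v (Suc t)"
      by (simp only: sum.lessThan_Suc[of _ "Suc t"] Suc.IH)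
    also have "\<dots> = h u - e (Suc t) u - real (Suc t) * survival v (Suc t) u"
      unfolding F by (simp add: e_def algebra_simps)
    finally show ?case .
  qed (simp add: e_def)
  then have "(\<lambda>t. \<Sum>s<Suc t. real s * first_passage_prob G u v s) \<longlonglongrightarrow> h u"
    using tendsto_diff[OF tendsto_diff[OF tendsto_const e_0] t_surv] by simp
  then have "(\<lambda>t. real t * first_passage_prob G u v t) sums h u"
    unfolding sums_def by (rule LIMSEQ_imp_Suc)
  then show ?thesis
    by (simp add: mean_first_passage_def sums_iff)
qed

end

section \<open>Kemeny's constant from effective resistances\<close>

text \<open>The effective resistance of a connected graph is
  \<open>R x y = L\<^sup>+ x x + L\<^sup>+ y y - 2 * L\<^sup>+ x y\<close> for the pseudo-inverse \<open>L\<^sup>+\<close> of the Laplacian \<open>L\<close>, so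
  \<open>L\<close> applied to \<open>\<lambda>x. R x j\<close> depends on \<open>j\<close> only through the term \<open>- 2\<close> at \<open>x = j\<close>. This property
  is all that is needed of it.\<close>

locale resistance = fin_graph +
  fixes R :: "'a \<Rightarrow> 'a \<Rightarrow> real" and q :: "'a \<Rightarrow> real"
  assumes sym: "x \<in> verts G \<Longrightarrow> y \<in> verts G \<Longrightarrow> R x y = R y x"
    and diag: "x \<in> verts G \<Longrightarrow> R x x = 0"
    and laplacian: "x \<in> verts G \<Longrightarrow> j \<in> verts G \<Longrightarrow>
      (\<Sum>y\<in>neighbours G x. R x j - R y j) = q x - (if x = j then 2 else 0)"
begin

definition weighted_resistance :: "'a \<Rightarrow> real" where
  "weighted_resistance x = (\<Sum>y\<in>verts G. deg G y * R x y)"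

text \<open>Tetali's formula: half the sum over \<open>z\<close> of
  \<open>deg G z * (R x j + R j z - R x z)\<close>. The target is the first argument.\<close>

definition hitting_time :: "'a \<Rightarrow> 'a \<Rightarrow> real" where
  "hitting_time j x = (total_deg G * R x j + weighted_resistance j - weighted_resistance x) / 2"

lemma hitting_time_self: "j \<in> verts G \<Longrightarrow> hitting_time j j = 0"
  by (simp add: hitting_time_def diag)

text \<open>The term \<open>q x\<close> enters through \<open>R x j\<close> and through
  \<open>weighted_resistance\<close> with the same factor and cancels.\<close>

lemma laplacian_hitting_time:
  assumes x: "x \<in> verts G" and j: "j \<in> verts G"
  shows "(\<Sum>y\<in>neighbours G x. hitting_time j x - hitting_time j y)
    = deg G x - (if x = j then total_deg G else 0)"
proof -
  let ?N = "neighbours G x"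
  have "(\<Sum>y\<in>?N. weighted_resistance x - weighted_resistance y)
      = (\<Sum>y\<in>?N. \<Sum>z\<in>verts G. deg G z * (R x z - R y z))"
    by (simp add: weighted_resistance_def right_diff_distrib sum_subtractf)
  also have "\<dots> = (\<Sum>z\<in>verts G. deg G z * (\<Sum>y\<in>?N. R x z - R y z))"
    by (subst sum.swap) (simp add: sum_distrib_left)
  also have "\<dots> = (\<Sum>z\<in>verts G. deg G z * q x - (if x = z then 2 * deg G z else 0))"
    by (intro sum.cong refl) (simp add: laplacian[OF x] algebra_simps)
  also have "\<dots> = total_deg G * q x - 2 * deg G x"
    using x finite_verts by (simp add: sum_subtractf total_deg_def sum_distrib_right)
  finally have w: "(\<Sum>y\<in>?N. weighted_resistance x - weighted_resistance y)
    = total_deg G * q x - 2 * deg G x" .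
  have "(\<Sum>y\<in>?N. hitting_time j x - hitting_time j y)
      = (\<Sum>y\<in>?N. total_deg G / 2 * (R x j - R y j) - (weighted_resistance x - weighted_resistance y) / 2)"
    by (intro sum.cong refl) (simp add: hitting_time_def field_simps)
  also have "\<dots> = total_deg G / 2 * (\<Sum>y\<in>?N. R x j - R y j)
      - (\<Sum>y\<in>?N. weighted_resistance x - weighted_resistance y) / 2"
    by (subst sum_subtractf) (simp only: sum_distrib_left sum_divide_distrib)
  also have "\<dots> = deg G x - (if x = j then total_deg G else 0)"
    unfolding w laplacian[OF x j] by (simp add: field_simps)
  finally show ?thesis .
qed

lemma hitting_time_step:
  assumes "x \<in> verts G" "j \<in> verts G"
  shows "(\<Sum>y\<in>neighbours G x. hitting_time j y) / deg G x
    = hitting_time j x - 1 + (if x = j then total_deg G / deg G j else 0)"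
  using laplacian_hitting_time[OF assms] deg_pos[OF assms(1)]
  by (auto simp: sum_subtractf deg_def field_simps split: if_splits)

lemma mean_first_passage_hitting_time:
  assumes "i \<in> verts G" "j \<in> verts G" "i \<noteq> j"
  shows "mean_first_passage G i j = hitting_time j i"
  using assms hitting_time_self by (intro mean_first_passage_eq) (auto simp: hitting_time_step)

section \<open>The stationary distribution\<close>

lemma pmf_step: "x \<in> verts G \<Longrightarrow> pmf (step G x) y = (if y \<in> neighbours G x then 1 / deg G x else 0)"
  using neighbours_nonempty finite_neighbours by (simp add: step_def deg_def indicator_def)

lemma pmf_bind_step:
  assumes "set_pmf \<pi> \<subseteq> verts G"
  shows "pmf (bind_pmf \<pi> (step G)) y = (\<Sum>x\<in>verts G. pmf \<pi> x * pmf (step G x) y)"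
  unfolding pmf_bind using assms finite_verts
  by (subst integral_measure_pmf_real[of "verts G"]) (auto simp: mult.commute)

text \<open>Average the one-step equation of \<open>hitting_time j\<close> over \<pi>: by
  stationarity the mean of the hitting time cancels, leaving
  \<open>0 = - 1 + pmf \<pi> j * total_deg G / deg G j\<close>.\<close>

lemma stationary_unique:
  assumes \<pi>: "set_pmf \<pi> \<subseteq> verts G" "bind_pmf \<pi> (step G) = \<pi>" and j: "j \<in> verts G"
  shows "pmf \<pi> j = deg G j / total_deg G"
proof -
  let ?V = "verts G" and ?h = "hitting_time j"
  have sum_1: "(\<Sum>x\<in>?V. pmf \<pi> x) = 1"
    using \<pi>(1) finite_verts by (simp add: sum_pmf_eq_1)
  have step: "(\<Sum>y\<in>?V. pmf (step G x) y * ?h y) = (\<Sum>y\<in>neighbours G x. ?h y) / deg G x"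
    if "x \<in> ?V" for x
  proof -
    have "(\<Sum>y\<in>?V. pmf (step G x) y * ?h y) = (\<Sum>y\<in>neighbours G x. pmf (step G x) y * ?h y)"
      using that finite_verts neighbours_subset by (intro sum.mono_neutral_right) (auto simp: pmf_step)
    then show ?thesis
      using that by (simp add: pmf_step sum_divide_distrib)
  qed
  have "(\<Sum>y\<in>?V. pmf \<pi> y * ?h y) = (\<Sum>y\<in>?V. \<Sum>x\<in>?V. pmf \<pi> x * pmf (step G x) y * ?h y)"
    by (subst (1) \<pi>(2)[symmetric]) (simp add: pmf_bind_step[OF \<pi>(1)] sum_distrib_right)
  also have "\<dots> = (\<Sum>x\<in>?V. pmf \<pi> x * (\<Sum>y\<in>?V. pmf (step G x) y * ?h y))"
    by (subst sum.swap) (simp add: sum_distrib_left mult.assoc)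
  also have "\<dots> = (\<Sum>x\<in>?V. pmf \<pi> x * ?h x - pmf \<pi> x + (if x = j then pmf \<pi> j * total_deg G / deg G j else 0))"
  proof (intro sum.cong refl)
    fix x assume x: "x \<in> ?V"
    show "pmf \<pi> x * (\<Sum>y\<in>?V. pmf (step G x) y * ?h y)
      = pmf \<pi> x * ?h x - pmf \<pi> x + (if x = j then pmf \<pi> j * total_deg G / deg G j else 0)"
      unfolding step[OF x] hitting_time_step[OF x j] by (simp add: algebra_simps)
  qed
  also have "\<dots> = (\<Sum>x\<in>?V. pmf \<pi> x * ?h x) - 1 + pmf \<pi> j * total_deg G / deg G j"
    using j finite_verts by (simp add: sum.distrib sum_subtractf sum_1)
  finally show ?thesis
    using deg_pos[OF j] total_deg_pos by (simp add: field_simps)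
qed

lemma stationary_exists:
  obtains \<pi> where "set_pmf \<pi> \<subseteq> verts G" "bind_pmf \<pi> (step G) = \<pi>"
proof -
  define f where "f x = (if x \<in> verts G then deg G x / total_deg G else 0)" for x
  define \<pi> where "\<pi> = embed_pmf f"
  have f_nonneg: "f x \<ge> 0" for x
    using deg_nonneg total_deg_pos by (simp add: f_def)
  have "(\<integral>\<^sup>+ x. ennreal (f x) \<partial>count_space UNIV) = (\<Sum>x\<in>verts G. ennreal (f x))"
    using finite_verts by (intro nn_integral_count_space') (auto simp: f_def)
  also have "\<dots> = ennreal (\<Sum>x\<in>verts G. f x)"
    using f_nonneg by (simp add: sum_ennreal)
  also have "(\<Sum>x\<in>verts G. f x) = 1"
    using total_deg_pos by (simp add: f_def flip: sum_divide_distrib) (simp add: total_deg_def)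
  finally have pmf: "pmf \<pi> x = f x" for x
    unfolding \<pi>_def using f_nonneg by (intro pmf_embed_pmf) auto
  have supp: "set_pmf \<pi> \<subseteq> verts G"
    by (auto simp: set_pmf_iff pmf f_def split: if_splits)
  have "pmf (bind_pmf \<pi> (step G)) y = f y" for y
  proof -
    \<comment> \<open>Detailed balance: every edge carries mass \<open>1 / total_deg G\<close> in
      each direction.\<close>
    have "(\<Sum>x\<in>verts G. pmf \<pi> x * pmf (step G x) y)
        = (\<Sum>x\<in>verts G. if y \<in> neighbours G x then 1 / total_deg G else 0)"
      using deg_pos by (intro sum.cong refl) (force simp: pmf f_def pmf_step)
    also have "\<dots> = real (card {x \<in> verts G. y \<in> neighbours G x}) / total_deg G"
      using finite_verts by (simp add: sum.If_cases Int_def)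
    also have "{x \<in> verts G. y \<in> neighbours G x} = (if y \<in> verts G then neighbours G y else {})"
      by (auto simp: neighbours_def insert_commute)
    finally show ?thesis
      by (simp add: pmf_bind_step[OF supp] f_def deg_def)
  qed
  then have "bind_pmf \<pi> (step G) = \<pi>"
    by (intro pmf_eqI) (simp add: pmf)
  with supp that show thesis by blast
qed

lemma pmf_stationary:
  assumes j: "j \<in> verts G"
  shows "pmf (stationary G) j = deg G j / total_deg G"
proof -
  obtain \<pi> where \<pi>: "set_pmf \<pi> \<subseteq> verts G" "bind_pmf \<pi> (step G) = \<pi>"
    by (rule stationary_exists)
  have "\<rho> = \<pi>" if \<rho>: "set_pmf \<rho> \<subseteq> verts G" "bind_pmf \<rho> (step G) = \<rho>" for \<rho>
  proof (rule pmf_eqI)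
    fix x
    show "pmf \<rho> x = pmf \<pi> x"
    proof (cases "x \<in> verts G")
      case True
      then show ?thesis by (simp add: stationary_unique[OF \<pi>] stationary_unique[OF \<rho>])
    next
      case False
      then have "x \<notin> set_pmf \<pi>" "x \<notin> set_pmf \<rho>" using \<pi>(1) \<rho>(1) by auto
      then show ?thesis by (simp add: set_pmf_iff)
    qed
  qed
  then have "stationary G = \<pi>"
    unfolding stationary_def using \<pi> by (intro the_equality) blast+
  then show ?thesis
    using stationary_unique[OF \<pi> j] by simp
qed

text \<open>In the sum over \<open>j\<close>, the terms \<open>R i j\<close> contribute
  \<open>weighted_resistance i / 2\<close> and the subtracted terms remove it again, so the value is
  independent of \<open>i\<close>.\<close>

theorem kemeny_eq:
  "kemeny G = (\<Sum>x\<in>verts G. deg G x * weighted_resistance x) / (2 * total_deg G)"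
proof -
  let ?V = "verts G" and ?W = "total_deg G"
  have "(\<Sum>j\<in>?V - {i}. mean_first_passage G i j * pmf (stationary G) j)
      = (\<Sum>x\<in>?V. deg G x * weighted_resistance x) / (2 * ?W)" if i: "i \<in> ?V" for i
  proof -
    have "(\<Sum>j\<in>?V - {i}. mean_first_passage G i j * pmf (stationary G) j)
        = (\<Sum>j\<in>?V - {i}. hitting_time j i * (deg G j / ?W))"
      using i by (intro sum.cong refl) (auto simp: mean_first_passage_hitting_time pmf_stationary)
    also have "\<dots> = (\<Sum>j\<in>?V. hitting_time j i * (deg G j / ?W))"
      using finite_verts i by (intro sum.mono_neutral_left) (auto simp: hitting_time_self)
    also have "\<dots> = (\<Sum>j\<in>?V. deg G j * R i j / 2 + deg G j * weighted_resistance j / (2 * ?W)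
        - deg G j * (weighted_resistance i / (2 * ?W)))"
      using total_deg_pos by (intro sum.cong refl) (simp add: hitting_time_def field_simps)
    also have "\<dots> = weighted_resistance i / 2
        + (\<Sum>x\<in>?V. deg G x * weighted_resistance x) / (2 * ?W)
        - ?W * (weighted_resistance i / (2 * ?W))"
      by (simp add: sum.distrib sum_subtractf weighted_resistance_def total_deg_def
          flip: sum_divide_distrib sum_distrib_right)
    finally show ?thesis
      using total_deg_pos by simp
  qed
  then show ?thesis
    unfolding kemeny_def using verts_nonempty by (intro the_equality) auto
qed

end

section \<open>Adding an edge\<close>

locale resistance_new_edge = resistance +
  fixes a b :: 'a
  assumes a: "a \<in> verts G" and b: "b \<in> verts G" and a_neq_b: "a \<noteq> b"
    and new: "{a, b} \<notin> edges G"
    and nonneg: "x \<in> verts G \<Longrightarrow> y \<in> verts G \<Longrightarrow> R x y \<ge> 0"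
begin

abbreviation G' :: "'a ugraph" where
  "G' \<equiv> add_edge G {a, b}"

text \<open>The voltage of a unit current entering at \<open>b\<close> and leaving at
  \<open>a\<close>.\<close>

definition potential :: "'a \<Rightarrow> real" where
  "potential x = (R x a - R x b) / 2"

text \<open>The Sherman--Morrison formula for the rank one change of the Laplacian.\<close>

definition R' :: "'a \<Rightarrow> 'a \<Rightarrow> real" where
  "R' x y = R x y - (potential x - potential y)\<^sup>2 / (1 + R a b)"

text \<open>Collects the terms free of \<open>j\<close> when the squares in
  \<open>R' x j - R' y j\<close> are expanded.\<close>

definition q' :: "'a \<Rightarrow> real" where
  "q' x = q x - (\<Sum>y\<in>neighbours G x. (potential x)\<^sup>2 - (potential y)\<^sup>2) / (1 + R a b)"

lemma verts_G': "verts G' = verts G"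
  by (simp add: add_edge_def)

lemma neighbours_G':
  "neighbours G' x = neighbours G x \<union> (if x = a then {b} else {}) \<union> (if x = b then {a} else {})"
  using a b a_neq_b by (auto simp: neighbours_def add_edge_def doubleton_eq_iff)

lemma sum_neighbours_G':
  "(\<Sum>y\<in>neighbours G' x. f y)
    = (\<Sum>y\<in>neighbours G x. f y) + (if x = a then f b else 0) + (if x = b then f a else 0)"
  for f :: "'a \<Rightarrow> real"
proof -
  have "b \<notin> neighbours G a" "a \<notin> neighbours G b"
    using new by (auto simp: neighbours_def insert_commute)
  then show ?thesis
    using a_neq_b finite_neighbours by (auto simp: neighbours_G')
qed

lemma deg_G': "deg G' x = deg G x + (if x = a then 1 else 0) + (if x = b then 1 else 0)"
  using sum_neighbours_G'[of "\<lambda>_. 1" x] by (simp add: deg_def)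

lemma sum_deg_G': "(\<Sum>x\<in>verts G. deg G' x * f x) = (\<Sum>x\<in>verts G. deg G x * f x) + f a + f b"
proof -
  have "(\<Sum>x\<in>verts G. deg G' x * f x) = (\<Sum>x\<in>verts G. deg G x * f x +
      (if x = a then f x else 0) + (if x = b then f x else 0))"
    by (intro sum.cong refl) (auto simp: deg_G' algebra_simps)
  then show ?thesis
    using a b finite_verts by (simp add: sum.distrib)
qed

lemma laplacian_potential:
  assumes x: "x \<in> verts G"
  shows "(\<Sum>y\<in>neighbours G x. potential x - potential y)
    = (if x = b then 1 else 0) - (if x = a then 1 else 0)"
proof -
  have "(\<Sum>y\<in>neighbours G x. potential x - potential y)
      = (\<Sum>y\<in>neighbours G x. (R x a - R y a) / 2 - (R x b - R y b) / 2)"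
    by (intro sum.cong refl) (simp add: potential_def field_simps)
  also have "\<dots> = (\<Sum>y\<in>neighbours G x. R x a - R y a) / 2 - (\<Sum>y\<in>neighbours G x. R x b - R y b) / 2"
    by (subst sum_subtractf) (simp only: sum_divide_distrib)
  also have "\<dots> = (if x = b then 1 else 0) - (if x = a then 1 else 0)"
    unfolding laplacian[OF x a] laplacian[OF x b] by (simp add: field_simps)
  finally show ?thesis .
qed

text \<open>The cross terms of the squares give \<open>2 * potential j / (1 + R a b)\<close> times
  the Laplacian of \<open>potential\<close>, which lives on \<open>a\<close> and \<open>b\<close>;
  the contribution of the new edge cancels exactly this.\<close>

lemma laplacian_R':
  assumes x: "x \<in> verts G" and j: "j \<in> verts G"
  shows "(\<Sum>y\<in>neighbours G' x. R' x j - R' y j) = q' x - (if x = j then 2 else 0)"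
proof -
  let ?g = potential and ?N = "neighbours G x"
  define c where "c = 1 + R a b"
  have c: "c > 0" using nonneg[OF a b] by (simp add: c_def)
  have ga: "?g a = - (c - 1) / 2" and gb: "?g b = (c - 1) / 2"
    using diag[OF a] diag[OF b] sym[OF a b] by (simp_all add: potential_def c_def)
  have gj: "R a j - R b j = 2 * ?g j"
    using sym[OF a j] sym[OF b j] by (simp add: potential_def)
  have ab: "R' a j - R' b j = 2 * ?g j / c"
  proof -
    have "R' a j - R' b j = 2 * ?g j - ((?g a - ?g j)\<^sup>2 - (?g b - ?g j)\<^sup>2) / c"
      unfolding gj[symmetric] by (simp add: R'_def c_def[symmetric] diff_divide_distrib)
    also have "(?g a - ?g j)\<^sup>2 - (?g b - ?g j)\<^sup>2 = 2 * (c - 1) * ?g j"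
      unfolding ga gb by (simp add: power2_eq_square field_simps)
    also have "2 * ?g j - 2 * (c - 1) * ?g j / c = 2 * ?g j / c"
      using c by (simp add: field_simps)
    finally show ?thesis .
  qed
  have "(\<Sum>y\<in>?N. R' x j - R' y j)
      = (\<Sum>y\<in>?N. (R x j - R y j) - ((?g x)\<^sup>2 - (?g y)\<^sup>2) / c + 2 * ?g j / c * (?g x - ?g y))"
    by (intro sum.cong refl)
      (simp add: R'_def c_def[symmetric] power2_eq_square diff_divide_distrib add_divide_distrib algebra_simps)
  also have "\<dots> = (\<Sum>y\<in>?N. R x j - R y j) - (\<Sum>y\<in>?N. (?g x)\<^sup>2 - (?g y)\<^sup>2) / c
      + 2 * ?g j / c * (\<Sum>y\<in>?N. ?g x - ?g y)"
    by (simp only: sum.distrib sum_subtractf[of "\<lambda>y. R x j - R y j" "\<lambda>y. ((?g x)\<^sup>2 - (?g y)\<^sup>2) / c"]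
        sum_divide_distrib sum_distrib_left)
  also have "\<dots> = q' x - (if x = j then 2 else 0)
      + 2 * ?g j / c * ((if x = b then 1 else 0) - (if x = a then 1 else 0))"
    unfolding laplacian[OF x j] laplacian_potential[OF x] by (simp add: q'_def c_def)
  finally show ?thesis
    unfolding sum_neighbours_G' using ab a_neq_b by auto
qed

sublocale new: resistance G' R' q'
proof
  show "neighbours G' u \<noteq> {}" if "u \<in> verts G'" for u
    using neighbours_nonempty[of u] that by (auto simp: verts_G' neighbours_G')
  show "R' x y = R' y x" if "x \<in> verts G'" "y \<in> verts G'" for x y
    using that sym by (simp add: verts_G' R'_def power2_commute)
  show "R' x x = 0" if "x \<in> verts G'" for x
    using that by (simp add: verts_G' R'_def diag)
qed (auto simp: verts_G' finite_verts verts_nonempty laplacian_R')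

text \<open>The left side, divided by \<open>1 + R a b\<close>, is the gain of the double sum from
  the two raised degrees; the right side, divided likewise, is the loss from the lowered
  resistances.\<close>

theorem kemeny_add_edge_le:
  assumes "2 * (1 + R a b) * (weighted_resistance a + weighted_resistance b + R a b)
    \<le> (\<Sum>x\<in>verts G. \<Sum>y\<in>verts G. deg G' x * deg G' y * (potential x - potential y)\<^sup>2)"
  shows "kemeny G' \<le> kemeny G"
proof -
  let ?V = "verts G"
  define c where "c = 1 + R a b"
  have c: "c > 0" using nonneg[OF a b] by (simp add: c_def)
  define K where "K = (\<Sum>x\<in>?V. deg G x * weighted_resistance x)"
  define S where "S = (\<Sum>x\<in>?V. \<Sum>y\<in>?V. deg G' x * deg G' y * (potential x - potential y)\<^sup>2)"
  have wr: "(\<Sum>x\<in>?V. deg G x * R x z) = weighted_resistance z" if "z \<in> ?V" for z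
    unfolding weighted_resistance_def using that by (intro sum.cong refl) (simp add: sym)
  have "K \<ge> 0"
    unfolding K_def weighted_resistance_def using nonneg deg_nonneg
    by (intro sum_nonneg mult_nonneg_nonneg) auto
  have "(\<Sum>x\<in>?V. deg G' x * new.weighted_resistance x)
      = (\<Sum>x\<in>?V. deg G' x * (\<Sum>y\<in>?V. deg G' y * R x y)) - S / c"
    unfolding new.weighted_resistance_def verts_G' S_def
    by (simp add: R'_def c_def sum_subtractf right_diff_distrib sum_divide_distrib sum_distrib_left mult.assoc)
  also have "(\<Sum>x\<in>?V. deg G' x * (\<Sum>y\<in>?V. deg G' y * R x y))
      = (\<Sum>x\<in>?V. deg G' x * (weighted_resistance x + R x a + R x b))"
    by (simp add: sum_deg_G' weighted_resistance_def)
  also have "\<dots> = K + (\<Sum>x\<in>?V. deg G x * R x a) + (\<Sum>x\<in>?V. deg G x * R x b)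
      + weighted_resistance a + weighted_resistance b + 2 * R a b"
    using a b by (simp add: sum_deg_G' K_def distrib_left sum.distrib diag sym[of b a])
  also have "\<dots> = K + 2 * (weighted_resistance a + weighted_resistance b + R a b)"
    using a b by (simp add: wr)
  also have "\<dots> - S / c \<le> K"
    using assms c unfolding S_def[symmetric] c_def[symmetric] by (simp add: field_simps)
  finally have le: "(\<Sum>x\<in>?V. deg G' x * new.weighted_resistance x) \<le> K" .
  have "total_deg G' = total_deg G + 2"
    using sum_deg_G'[of "\<lambda>_. 1"] by (simp add: total_deg_def verts_G')
  \<comment> \<open>The denominator also grows with the new edge, which only lowers the
    quotient.\<close>
  have "kemeny G' \<le> K / (2 * total_deg G')"
    unfolding new.kemeny_eq verts_G' using le new.total_deg_pos by (intro divide_right_mono) auto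
  also have "\<dots> \<le> K / (2 * total_deg G)"
    using \<open>K \<ge> 0\<close> total_deg_pos \<open>total_deg G' = _\<close> by (intro divide_left_mono) auto
  finally show ?thesis
    by (simp add: kemeny_eq K_def)
qed

end

section \<open>Brooms\<close>

text \<open>Graph distance, which in a tree is the effective resistance. \<open>min x k\<close>
  moves a leaf to the center at cost 1; the case \<open>x = y\<close> is separate because distinct
  leaves are 2 apart.\<close>

definition broom_dist :: "nat \<Rightarrow> nat \<Rightarrow> nat \<Rightarrow> real" where
  "broom_dist k x y = (if x = y then 0 else
     \<bar>real (min x k) - real (min y k)\<bar> + (if x > k then 1 else 0) + (if y > k then 1 else 0))"

lemma neighbours_broom:
  assumes "k \<ge> 2" "x \<in> {1..k + p}"
  shows "neighbours (broom k p) x =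
    (if x > k then {k} else if x = k then insert (k - 1) {k + 1..k + p}
     else if x = 1 then {2} else {x - 1, x + 1})"
  using assms
  by (auto simp: neighbours_def broom_def doubleton_eq_iff) (auto intro!: exI[of _ "x - 1"])

lemma deg_broom:
  assumes "k \<ge> 2" "x \<in> {1..k + p}"
  shows "deg (broom k p) x =
    (if x > k then 1 else if x = k then real p + 1 else if x = 1 then 1 else 2)"
  using assms by (auto simp: deg_def neighbours_broom)

text \<open>In a tree all neighbours of \<open>x\<close> are one step farther from \<open>j\<close>
  than \<open>x\<close>, except the one towards \<open>j\<close> if
  \<open>x \<noteq> j\<close>.\<close>

lemma laplacian_broom_dist:
  assumes k: "k \<ge> 2" and x: "x \<in> {1..k + p}" and j: "j \<in> {1..k + p}"
  shows "(\<Sum>y\<in>neighbours (broom k p) x. broom_dist k x j - broom_dist k y j)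
    = 2 - deg (broom k p) x - (if x = j then 2 else 0)"
proof -
  consider "x > k" | "x = k" | "x = 1" "x < k" | "1 < x" "x < k"
    using x by fastforce
  then show ?thesis
  proof cases
    case 2
    have "(\<Sum>l\<in>{k + 1..k + p}. broom_dist k k j - broom_dist k l j)
        = (\<Sum>l\<in>{k + 1..k + p}. (if l = j then 2 else 0) - 1)"
      by (intro sum.cong refl) (auto simp: broom_dist_def min_def)
    also have "\<dots> = (if j > k then 2 else 0) - real p"
      using j by (simp add: sum_subtractf)
    finally have "(\<Sum>l\<in>{k + 1..k + p}. broom_dist k k j - broom_dist k l j)
      = (if j > k then 2 else 0) - real p" .
    moreover have "broom_dist k k j - broom_dist k (k - 1) j = (if j < k then 1 else -1)"
      using k by (auto simp: broom_dist_def min_def)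
    ultimately show ?thesis
      using 2 k x by (auto simp: neighbours_broom deg_broom)
  next
    case 1
    then show ?thesis
      using k x j by (auto simp: neighbours_broom deg_broom broom_dist_def min_def)
  next
    case 3
    then show ?thesis
      using k x j by (auto simp: neighbours_broom deg_broom broom_dist_def min_def)
  next
    case 4
    then show ?thesis
      using k x j by (cases j x rule: linorder_cases) (auto simp: neighbours_broom deg_broom broom_dist_def min_def)
  qed
qed

lemma resistance_broom:
  assumes "k \<ge> 2"
  shows "resistance (broom k p) (broom_dist k) (\<lambda>x. 2 - deg (broom k p) x)"
proof
  have verts: "verts (broom k p) = {1..k + p}" by (simp add: broom_def)
  show "finite (verts (broom k p))" "verts (broom k p) \<noteq> {}"
    using assms by (auto simp: verts)
  show "neighbours (broom k p) u \<noteq> {}" if "u \<in> verts (broom k p)" for u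
    using that assms by (auto simp: verts neighbours_broom)
  show "(\<Sum>y\<in>neighbours (broom k p) x. broom_dist k x j - broom_dist k y j)
    = 2 - deg (broom k p) x - (if x = j then 2 else 0)"
    if "x \<in> verts (broom k p)" "j \<in> verts (broom k p)" for x j
    using laplacian_broom_dist[OF assms] that unfolding verts by blast
qed (auto simp: broom_dist_def)

lemma broom_dist_le:
  assumes "k \<ge> 2" "x \<ge> 1" "y \<ge> 1"
  shows "broom_dist k x y \<le> real k"
  using assms by (auto simp: broom_dist_def min_def)

text \<open>With \<open>t = k - i\<close>, the two sides of the criterion are at most
  \<open>66 * t * k^2\<close> and at least \<open>p * k * t^2 / 8\<close>; hence the constant 528 =
  66 * 8.\<close>

lemma kemeny_broom_add_edge_le:
  assumes k: "k \<ge> 2" and "p \<le> k" and i: "1 \<le> i" "i < k" and l: "l \<in> {k + 1..k + p}"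
    and large: "528 * k \<le> p * (k - i)"
  shows "kemeny (add_edge (broom k p) {i, l}) \<le> kemeny (broom k p)"
proof -
  have verts: "verts (broom k p) = {1..k + p}" by (simp add: broom_def)
  interpret resistance "broom k p" "broom_dist k" "\<lambda>x. 2 - deg (broom k p) x"
    using k by (rule resistance_broom)
  interpret resistance_new_edge "broom k p" "broom_dist k" "\<lambda>x. 2 - deg (broom k p) x" i l
    using i l by unfold_locales (auto simp: verts broom_dist_def broom_def doubleton_eq_iff)
  define t where "t = real (k - i)"
  have t: "t \<ge> 1" "t = real k - real i"
    using i by (auto simp: t_def)
  have "total_deg (broom k p) \<le> (\<Sum>x\<in>{1..k + p}. 2 + (if x = k then real p else 0))"
    unfolding total_deg_def verts using k by (intro sum_mono) (auto simp: deg_broom)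
  also have "\<dots> \<le> 5 * real k"
    using k \<open>p \<le> k\<close> by (simp add: sum.distrib)
  finally have total: "total_deg (broom k p) \<le> 5 * real k" .
  have wr: "weighted_resistance x \<le> 5 * (real k)\<^sup>2" if "x \<ge> 1" for x
  proof -
    have "weighted_resistance x \<le> (\<Sum>y\<in>verts (broom k p). deg (broom k p) y * real k)"
      unfolding weighted_resistance_def
      using k that by (intro sum_mono mult_left_mono broom_dist_le deg_nonneg) (auto simp: verts)
    also have "\<dots> = total_deg (broom k p) * real k"
      by (simp add: total_deg_def sum_distrib_right)
    also have "\<dots> \<le> 5 * real k * real k"
      using total by (intro mult_right_mono) auto
    finally show ?thesis by (simp add: power2_eq_square)
  qed
  have R_il: "broom_dist k i l = t + 1"
    using i l by (auto simp: broom_dist_def t_def min_def)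
  have "t + 1 \<le> (real k)\<^sup>2"
  proof -
    have "t + 1 \<le> real k * 1" using t i by simp
    also have "\<dots> \<le> real k * real k" using k by (intro mult_left_mono) auto
    finally show ?thesis by (simp add: power2_eq_square)
  qed
  then have sum_le: "weighted_resistance i + weighted_resistance l + broom_dist k i l \<le> 11 * (real k)\<^sup>2"
    using wr[of i] wr[of l] i l R_il by simp
  \<comment> \<open>\<open>1 + broom_dist k i l = t + 2\<close> is at most \<open>3 * t\<close>,
    since \<open>t \<ge> 1\<close>.\<close>
  have "2 * (1 + broom_dist k i l) * (weighted_resistance i + weighted_resistance l + broom_dist k i l)
      \<le> (6 * t) * (11 * (real k)\<^sup>2)"
  proof (rule mult_mono[OF _ sum_le])
    show "0 \<le> weighted_resistance i + weighted_resistance l + broom_dist k i l"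
      unfolding weighted_resistance_def
      by (intro add_nonneg_nonneg sum_nonneg mult_nonneg_nonneg deg_nonneg) (auto simp: broom_dist_def)
  qed (use t R_il in auto)
  also have "\<dots> = (528 * real k) * (real k * t / 8)"
    by (simp add: power2_eq_square)
  also have "\<dots> \<le> (real p * t) * (real k * t / 8)"
  proof (rule mult_right_mono)
    have "real (528 * k) \<le> real (p * (k - i))" using large by (rule of_nat_mono)
    then show "528 * real k \<le> real p * t" by (simp add: t_def)
  qed (use t in auto)
  also have "\<dots> = real k / 2 * (real p * (t / 2)\<^sup>2)"
    by (simp add: power2_eq_square)
  also have "\<dots> \<le> real (card {1..(i + k) div 2}) * (real p * (t / 2)\<^sup>2)"
    using i by (intro mult_right_mono) auto
  also have "\<dots> = (\<Sum>y\<in>{1..(i + k) div 2}. real p * (t / 2)\<^sup>2)"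
    by simp
  also have "\<dots> \<le> (\<Sum>y\<in>{1..(i + k) div 2}. deg G' k * deg G' y * (potential k - potential y)\<^sup>2)"
  proof (rule sum_mono)
    fix y assume y: "y \<in> {1..(i + k) div 2}"
    \<comment> \<open>The potential difference is \<open>t\<close> for \<open>y \<le> i\<close> and
      drops by 1 per step beyond \<open>i\<close>, so it is still at least \<open>t / 2\<close> up
      to the midpoint of \<open>i\<close> and \<open>k\<close>.\<close>
    have "broom_dist k k i = t" "broom_dist k k l = 1"
      "broom_dist k y i = \<bar>real y - real i\<bar>" "broom_dist k y l = real k - real y + 1"
      using y i l by (auto simp: broom_dist_def t(2) min_def)
    moreover have "2 * real y \<le> real i + real k"
      using y by auto
    ultimately have "potential k - potential y \<ge> t / 2"
      using i by (simp add: potential_def t(2) field_simps abs_if)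
    then have "(t / 2)\<^sup>2 \<le> (potential k - potential y)\<^sup>2"
      using t by (intro power_mono) auto
    moreover have "deg G' k \<ge> real p" "deg G' y \<ge> 1"
      using k y i by (auto simp: deg_G' deg_broom)
    then have "real p * 1 \<le> deg G' k * deg G' y"
      by (intro mult_mono) auto
    ultimately show "real p * (t / 2)\<^sup>2 \<le> deg G' k * deg G' y * (potential k - potential y)\<^sup>2"
      by (intro mult_mono) auto
  qed
  \<comment> \<open>All terms are nonnegative, so the row \<open>x = k\<close> and its first half of
    the path bound the double sum from below.\<close>
  also have "\<dots> \<le> (\<Sum>y\<in>verts (broom k p). deg G' k * deg G' y * (potential k - potential y)\<^sup>2)"
    using i by (intro sum_mono2 mult_nonneg_nonneg new.deg_nonneg) (auto simp: verts)
  also have "\<dots> \<le> (\<Sum>x\<in>verts (broom k p). \<Sum>y\<in>verts (broom k p).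
      deg G' x * deg G' y * (potential x - potential y)\<^sup>2)"
    using k by (intro member_le_sum[of k] sum_nonneg mult_nonneg_nonneg new.deg_nonneg) (auto simp: verts)
  finally show ?thesis
    by (rule kemeny_add_edge_le)
qed

lemma B\<^sub>2_le:
  assumes "k \<ge> 2" "p \<ge> 1" "p \<le> k"
  shows "B\<^sub>2 k p \<le> 528 * k"
proof -
  \<comment> \<open>Here \<open>t\<close> stands for \<open>k - i\<close>; it starts at 1 because
    \<open>k\<close> is already joined to every leaf. Values \<open>t > k\<close> merely enlarge the
    covering set.\<close>
  let ?T = "(\<lambda>(t, l). {k - t, l}) ` ({1..528 * k div p} \<times> {k + 1..k + p})"
  have "braess_edges (broom k p) \<inter> {{i, l} | i l. i \<in> {1..k} \<and> l \<in> {k + 1..k + p}} \<subseteq> ?T"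
  proof clarify
    fix i l
    assume il: "{i, l} \<in> braess_edges (broom k p)" "i \<in> {1..k}" "l \<in> {k + 1..k + p}"
    then have new: "{i, l} \<notin> edges (broom k p)"
      and less: "kemeny (broom k p) < kemeny (add_edge (broom k p) {i, l})"
      by (auto simp: braess_edges_def)
    have "i \<noteq> k" using new il by (auto simp: broom_def)
    with il have i: "1 \<le> i" "i < k" by auto
    have "\<not> 528 * k \<le> p * (k - i)"
      using kemeny_broom_add_edge_le[of k p i l] assms i il less by auto
    then have "k - i \<le> 528 * k div p"
      using \<open>p \<ge> 1\<close> by (simp add: less_eq_div_iff_mult_less_eq mult.commute)
    then show "{i, l} \<in> ?T"
      using i il by (intro image_eqI[of _ _ "(k - i, l)"]) auto
  qed
  then have "B\<^sub>2 k p \<le> card ?T"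
    unfolding B\<^sub>2_def by (intro card_mono) auto
  also have "\<dots> \<le> card ({1..528 * k div p} \<times> {k + 1..k + p})"
    by (intro card_image_le) auto
  also have "\<dots> \<le> 528 * k"
    by simp
  finally show ?thesis .
qed

theorem theorem5p15:
  fixes k p n :: "nat \<Rightarrow> nat"
  assumes "\<And>m. k m \<ge> 3"
    and "\<And>m. p m \<ge> 2"
    and "\<And>m. n m = p m + k m"
    and "filterlim n at_top sequentially"
    and "(\<lambda>m. real (p m) / real (k m)) \<longlonglongrightarrow> 0"
  shows "(\<lambda>m. real (B\<^sub>2 (k m) (p m))) \<in> O(\<lambda>m. real (k m))"
proof (rule bigoI)
  \<comment> \<open>A ratio below 1 gives \<open>p m \<le> k m\<close>, the range in which the bound
    \<open>528 * k\<close> holds.\<close>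
  have "\<forall>\<^sub>F m in sequentially. real (p m) / real (k m) < 1"
    using assms(5) by (rule order_tendstoD) simp
  then show "\<forall>\<^sub>F m in sequentially. norm (real (B\<^sub>2 (k m) (p m))) \<le> 528 * norm (real (k m))"
  proof eventually_elim
    case (elim m)
    have "p m \<le> k m"
      using elim assms(1)[of m] by (simp add: divide_less_eq split: if_splits)
    then have "B\<^sub>2 (k m) (p m) \<le> 528 * k m"
      using assms(1)[of m] assms(2)[of m] by (intro B\<^sub>2_le) auto
    then have "real (B\<^sub>2 (k m) (p m)) \<le> real (528 * k m)"
      by (rule of_nat_mono)
    then show ?case by simp
  qed
qed

end
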